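(* Let $$\tau^{l}\triangleq\inf\{t\ge0:\ \tilde\Phi^{(0)}_t+\tilde\Phi^{(1)}_t\ge\lambda/c\}.$$ If there is an optimal stopping time $\tau^*$ for the problem defining $V$, then $\tau^*\ge\tau^l$ (almost surely).
   Context: Parameters: $\lambda>0$, $\mu>0$, $c>0$, $m\in(1,2)$. On a probability space with measure $\mathbb{P}_0$, $N=(N_t)_{t\ge0}$ is a Poisson process with rate $\mu$ and jump times $\sigma_1<\sigma_2<\dots$ ($\sigma_0=0$), and $Y_1,Y_2,\dots$ are i.i.d. strictly positive random variables with common distribution $\beta_0$ on $\mathbb{R}^d$, independent of $N$. $X_t=X_0+\sum_{k=1}^{N_t}Y_k$, $\mathbb{F}$ is the natural filtration of $X$, and $\mathcal{S}$ is the set of $\mathbb{F}$-stopping times (the value $+\infty$ is allowed). $\beta_1$ is a probability measure on $\mathbb{R}^d$ with $\beta_0,\beta_1$ mutually absolutely continuous and $r=d\beta_1/d\beta_0$. Define $x(t,x_0)=-\frac{\lambda(2-m)}{\lambda-1}+e^{(\lambda-1)t}\left[x_0+\frac{\lambda(2-m)}{\lambda-1}\right]$ if $\lambda\ne1$ and $x(t,x_0)=x_0+(2-m)t$ if $\lambda=1$; $y(t,y_0)=-\frac{\lambda(m-1)}{\lambda-2}+e^{(\lambda-2)t}\left[y_0+\frac{\lambda(m-1)}{\lambda-2}\right]$ if $\lambda\ne2$ and $y(t,y_0)=y_0+2(m-1)t$ if $\lambda=2$. The piecewise deterministic Markov process $\tilde\Phi=(\tilde\Phi^{(0)},\tilde\Phi^{(1)})$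 in $\mathbb{R}_+^2$ (with $\mathbb{R}_+=[0,\infty)$), started at $\tilde\Phi_0=(\phi_0,\phi_1)$, is given by $\tilde\Phi^{(0)}_t=x(t-\sigma_n,\tilde\Phi^{(0)}_{\sigma_n})$, $\tilde\Phi^{(1)}_t=y(t-\sigma_n,\tilde\Phi^{(1)}_{\sigma_n})$ for $\sigma_n\le t<\sigma_{n+1}$, $n\ge0$, and $\tilde\Phi^{(0)}_{\sigma_n}=(1+\frac1\mu)r(Y_n)\tilde\Phi^{(0)}_{\sigma_n-}$, $\tilde\Phi^{(1)}_{\sigma_n}=(1+\frac2\mu)r(Y_n)\tilde\Phi^{(1)}_{\sigma_n-}$ for $n\ge1$. $\mathbb{E}_0^{\phi_0,\phi_1}$ is the $\mathbb{P}_0$-expectation given $\tilde\Phi_0=(\phi_0,\phi_1)$. The running cost is $g(\phi_0,\phi_1)=\phi_0+\phi_1-\frac{\lambda}{c}$ and the value function is $V(\phi_0,\phi_1)=\inf_{\tau\in\mathcal{S}}\mathbb{E}_0^{\phi_0,\phi_1}\left[\int_0^{\tau}e^{-\lambda t}g(\tilde\Phi_t)\,dt\right]$; a stopping time is optimal if it attains this infimum. *)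

theory Defs
  imports "HOL-Probability.Probability"
begin

text \<open>
  Lebesgue integral with values in the extended reals, positive part minus negative part.
  (The Bochner integral returns 0 for non-integrable functions, whereas the costs below may
  equal \<open>\<infinity>\<close>; their negative parts always have finite integral, so \<open>\<infinity> - \<infinity>\<close>
  does not occur.)
\<close>

definition ext_integral :: "'a measure \<Rightarrow> ('a \<Rightarrow> ereal) \<Rightarrow> ereal" where
  "ext_integral M f =
     enn2ereal (\<integral>\<^sup>+ x. e2ennreal (f x) \<partial>M) - enn2ereal (\<integral>\<^sup>+ x. e2ennreal (- f x) \<partial>M)"

definition natural_filtration ::
    "'a measure \<Rightarrow> (real \<Rightarrow> 'a \<Rightarrow> 'b::topological_space) \<Rightarrow> ennreal \<Rightarrow> 'a measure" where
  "natural_filtration M X t =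
     sigma (space M) {X s -` A \<inter> space M | s A. 0 \<le> s \<and> ennreal s \<le> t \<and> A \<in> sets borel}"

text \<open>Only times \<open>t \<ge> 0\<close> matter; path regularity is required of every path.\<close>

definition poisson_process :: "'a measure \<Rightarrow> real \<Rightarrow> (real \<Rightarrow> 'a \<Rightarrow> nat) \<Rightarrow> bool" where
  "poisson_process M rate N \<longleftrightarrow>
     (\<forall>t\<ge>0. N t \<in> M \<rightarrow>\<^sub>M count_space UNIV) \<and>
     (\<forall>\<omega>\<in>space M. N 0 \<omega> = 0 \<and> mono_on {0..} (\<lambda>t. N t \<omega>) \<and>
        (\<forall>t\<ge>0. continuous (at_right t) (\<lambda>s. N s \<omega>))) \<and>
     (\<forall>n t. 0 \<le> t 0 \<and> (\<forall>i<n. t i < t (Suc i)) \<longrightarrow>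
        prob_space.indep_vars M (\<lambda>_. count_space UNIV)
          (\<lambda>i \<omega>. N (t (Suc i)) \<omega> - N (t i) \<omega>) {..<n}) \<and>
     (\<forall>s t. 0 \<le> s \<and> s < t \<longrightarrow>
        distr M (count_space UNIV) (\<lambda>\<omega>. N t \<omega> - N s \<omega>) = measure_pmf (poisson_pmf (rate * (t - s))))"

definition jump_time :: "(real \<Rightarrow> 'a \<Rightarrow> nat) \<Rightarrow> nat \<Rightarrow> 'a \<Rightarrow> real" where
  "jump_time N n \<omega> = Inf {t. 0 \<le> t \<and> n \<le> N t \<omega>}"

definition x_flow :: "real \<Rightarrow> real \<Rightarrow> real \<Rightarrow> real \<Rightarrow> real" where
  "x_flow lam m t x0 =
     (if lam = 1 then x0 + (2 - m) * t
      else - (lam * (2 - m) / (lam - 1)) + exp ((lam - 1) * t) * (x0 + lam * (2 - m) / (lam - 1)))"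

definition y_flow :: "real \<Rightarrow> real \<Rightarrow> real \<Rightarrow> real \<Rightarrow> real" where
  "y_flow lam m t y0 =
     (if lam = 2 then y0 + 2 * (m - 1) * t
      else - (lam * (m - 1) / (lam - 2)) + exp ((lam - 2) * t) * (y0 + lam * (m - 1) / (lam - 2)))"

text \<open>
  Value right after the \<open>n\<close>-th jump of the deterministic-flow process with jump times \<open>s 1, s 2, \<dots>\<close>
  (and \<open>s 0 = 0\<close>) and jump factors \<open>a 1, a 2, \<dots>\<close>, started at \<open>p\<close>. Since the flow is continuous
  in time, the left limit at \<open>s (Suc n)\<close> is the flow run for time \<open>s (Suc n) - s n\<close>.
\<close>

primrec post_jump ::
    "(real \<Rightarrow> real \<Rightarrow> real) \<Rightarrow> (nat \<Rightarrow> real) \<Rightarrow> (nat \<Rightarrow> real) \<Rightarrow> real \<Rightarrow> nat \<Rightarrow> real" where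
  "post_jump flow s a p 0 = p"
| "post_jump flow s a p (Suc n) = a (Suc n) * flow (s (Suc n) - s n) (post_jump flow s a p n)"

text \<open>
  \<open>lam\<close> is the parameter \<open>\<lambda>\<close>. The marks are \<open>Y 1, Y 2, \<dots>\<close>; \<open>Y 0\<close> is unused. The density \<open>r\<close> is any
  nonnegative finite version of the Radon--Nikodym derivative of \<open>\<beta>1\<close> with respect to \<open>\<beta>0\<close>.
\<close>

locale compound_poisson_disorder = prob_space M
  for M :: "'a measure" +
  fixes lam \<mu> c m :: real
    and N :: "real \<Rightarrow> 'a \<Rightarrow> nat"
    and Y :: "nat \<Rightarrow> 'a \<Rightarrow> real ^ 'd"
    and X0 :: "'a \<Rightarrow> real ^ 'd"
    and \<beta>0 \<beta>1 :: "(real ^ 'd) measure"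
    and r :: "real ^ 'd \<Rightarrow> real"
  assumes lam_pos: "0 < lam" and \<mu>_pos: "0 < \<mu>" and c_pos: "0 < c"
    and m_range: "1 < m" "m < 2"
    and poisson: "poisson_process M \<mu> N"
    and jumps_exist: "\<And>\<omega> n. \<omega> \<in> space M \<Longrightarrow> \<exists>t\<ge>0. n \<le> N t \<omega>"
    and jumps_strict: "\<And>\<omega> n. \<omega> \<in> space M \<Longrightarrow> jump_time N n \<omega> < jump_time N (Suc n) \<omega>"
    and Y_indep: "indep_vars (\<lambda>_. borel) Y {1..}"
    and Y_distr: "\<And>k. 1 \<le> k \<Longrightarrow> distr M borel (Y k) = \<beta>0"
    and Y_pos: "\<And>\<omega> k i. \<omega> \<in> space M \<Longrightarrow> 1 \<le> k \<Longrightarrow> 0 < Y k \<omega> $ i"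
    and N_Y_indep:
      "indep_set (sigma_sets (space M) {N t -` A \<inter> space M | t A. 0 \<le> t})
                 (sigma_sets (space M) {Y k -` A \<inter> space M | k A. 1 \<le> k \<and> A \<in> sets borel})"
    and X0_measurable: "X0 \<in> borel_measurable M"
    and \<beta>1_prob: "prob_space \<beta>1" and \<beta>1_sets: "sets \<beta>1 = sets borel"
    and ac: "absolutely_continuous \<beta>0 \<beta>1" "absolutely_continuous \<beta>1 \<beta>0"
    and r_measurable: "r \<in> borel_measurable borel"
    and r_nonneg: "\<And>y. 0 \<le> r y"
    and r_density: "density \<beta>0 (\<lambda>y. ennreal (r y)) = \<beta>1"
begin

definition X :: "real \<Rightarrow> 'a \<Rightarrow> real ^ 'd" where
  "X t \<omega> = X0 \<omega> + (\<Sum>k = 1..N t \<omega>. Y k \<omega>)"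

definition stopping_times :: "('a \<Rightarrow> ennreal) set" where
  "stopping_times = {\<tau>. stopping_time (natural_filtration M X) \<tau>}"

definition Phi0 :: "real \<Rightarrow> real \<Rightarrow> 'a \<Rightarrow> real" where
  "Phi0 \<phi>0 t \<omega> =
     x_flow lam m (t - jump_time N (N t \<omega>) \<omega>)
       (post_jump (x_flow lam m) (\<lambda>n. jump_time N n \<omega>) (\<lambda>n. (1 + 1 / \<mu>) * r (Y n \<omega>)) \<phi>0 (N t \<omega>))"

definition Phi1 :: "real \<Rightarrow> real \<Rightarrow> 'a \<Rightarrow> real" where
  "Phi1 \<phi>1 t \<omega> =
     y_flow lam m (t - jump_time N (N t \<omega>) \<omega>)
       (post_jump (y_flow lam m) (\<lambda>n. jump_time N n \<omega>) (\<lambda>n. (1 + 2 / \<mu>) * r (Y n \<omega>)) \<phi>1 (N t \<omega>))"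

definition g :: "real \<Rightarrow> real \<Rightarrow> real" where
  "g \<phi>0 \<phi>1 = \<phi>0 + \<phi>1 - lam / c"

definition expected_cost :: "real \<Rightarrow> real \<Rightarrow> ('a \<Rightarrow> ennreal) \<Rightarrow> ereal" where
  "expected_cost \<phi>0 \<phi>1 \<tau> =
     ext_integral M (\<lambda>\<omega>. ext_integral lborel (\<lambda>t.
       ereal (indicator {t. 0 \<le> t \<and> ennreal t < \<tau> \<omega>} t *
              (exp (- lam * t) * g (Phi0 \<phi>0 t \<omega>) (Phi1 \<phi>1 t \<omega>)))))"

definition V :: "real \<Rightarrow> real \<Rightarrow> ereal" where
  "V \<phi>0 \<phi>1 = (INF \<tau>\<in>stopping_times. expected_cost \<phi>0 \<phi>1 \<tau>)"

definition optimal :: "real \<Rightarrow> real \<Rightarrow> ('a \<Rightarrow> ennreal) \<Rightarrow> bool" where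
  "optimal \<phi>0 \<phi>1 \<tau> \<longleftrightarrow> \<tau> \<in> stopping_times \<and> expected_cost \<phi>0 \<phi>1 \<tau> = V \<phi>0 \<phi>1"

definition tau_l :: "real \<Rightarrow> real \<Rightarrow> 'a \<Rightarrow> ennreal" where
  "tau_l \<phi>0 \<phi>1 \<omega> = Inf {ennreal t | t. 0 \<le> t \<and> Phi0 \<phi>0 t \<omega> + Phi1 \<phi>1 t \<omega> \<ge> lam / c}"

end

end

theory Submission
  imports Defs
begin

text \<open>
  Before \<open>\<tau>\<^sup>l\<close> the running cost \<open>g\<close> is strictly negative, so stopping earlier forgoes a sure gain.
  To turn this into a proof, an optimal \<open>\<tau>\<close> is compared with \<open>\<rho> = max \<tau> \<tau>\<^sup>l\<close>. Path by path
  the cost of \<open>\<rho>\<close> is at most that of \<open>\<tau>\<close>, and the integrands differ at every time in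
  \<open>[\<tau>, \<tau>\<^sup>l)\<close>. Optimality forces equality of the expected costs; since the quantities
  involved are finite, this gives equality of the path costs almost surely, and then equality of the
  integrands at almost every time, so that \<open>[\<tau>, \<tau>\<^sup>l)\<close> is a null set of times, hence empty. Both
  passages from equal integrals to equal integrands are instances of \<open>ext_integral_le_imp_AE_eq\<close>.
  Finiteness comes from \<open>g \<ge> -\<lambda>/c\<close>, which bounds the negative part of every path cost by \<open>1/c\<close>,
  and from the stopping time \<open>0\<close>, which bounds the optimal cost by \<open>0\<close>.

  For \<open>\<rho>\<close> to be admissible, \<open>\<tau>\<^sup>l\<close> must be a stopping time of the natural filtration of \<open>X\<close>,
  which is neither completed nor made right-continuous (\<open>tau_l_stopping_time\<close>).
  Since all marks are positive, \<open>X\<close> reveals its own jumps; so the number of jumps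
  before \<open>t\<close>, their times and their marks are known at time \<open>t\<close>, and with them the path of
  \<open>\<Phi>\<close> up to \<open>t\<close>. The sum \<open>\<Phi>0 + \<Phi>1\<close> is right-continuous and the level set is closed, so
  \<open>\<tau>\<^sup>l \<le> t\<close> means that the level is attained at some time in \<open>[0, t]\<close>. A left limit
  at a jump may reach the level although the process does not, so a countable dense set of times cannot
  simply replace \<open>[0, t]\<close>. Instead, each stretch from the last jump before a rational \<open>v\<close> up to \<open>v\<close>
  is treated separately: there the path is continuous on a compact interval, and attaining the level
  is the same as coming arbitrarily close to it at rational points.
\<close>

section \<open>Integrals of extended real functions\<close>

lemma ext_integral_mono:
  assumes "\<And>x. f x \<le> h x"
  shows "ext_integral M f \<le> ext_integral M h"
  unfolding ext_integral_def
  by (intro ereal_minus_mono) (auto simp: less_eq_ennreal.rep_eq[symmetric] assms intro!: nn_integral_mono e2ennreal_mono)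

lemma nn_integral_eq_imp_AE_eq:
  assumes [measurable]: "f \<in> borel_measurable M" "h \<in> borel_measurable M"
    and le: "\<And>x. f x \<le> h x"
    and fin: "(\<integral>\<^sup>+ x. f x \<partial>M) < \<infinity>"
    and eq: "(\<integral>\<^sup>+ x. h x \<partial>M) \<le> (\<integral>\<^sup>+ x. f x \<partial>M)"
  shows "AE x in M. f x = h x"
proof -
  have "(\<integral>\<^sup>+ x. h x - f x \<partial>M) = (\<integral>\<^sup>+ x. h x \<partial>M) - (\<integral>\<^sup>+ x. f x \<partial>M)"
    using fin le by (intro nn_integral_diff) auto
  also have "\<dots> = 0"
    using eq by (simp add: diff_eq_0_iff_ennreal) (metis eq fin infinity_ennreal_def order.strict_trans1)
  finally have "AE x in M. h x - f x = 0"
    by (subst (asm) nn_integral_0_iff_AE) auto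
  then show ?thesis
    by eventually_elim (metis diff_eq_0_iff_ennreal le antisym)
qed

text \<open>
  The finiteness conditions exclude \<open>\<infinity>\<close> from all four integrals of positive and negative
  parts, so the inequality between the differences splits into one equality for the positive and one
  for the negative parts.
\<close>

lemma ext_integral_le_imp_AE_eq:
  assumes [measurable]: "f \<in> borel_measurable M" "h \<in> borel_measurable M"
    and le: "\<And>x. f x \<le> h x"
    and fin: "(\<integral>\<^sup>+ x. e2ennreal (- f x) \<partial>M) < \<infinity>"
    and hfin: "ext_integral M h < \<infinity>"
    and ge: "ext_integral M h \<le> ext_integral M f"
  shows "AE x in M. f x = h x"
proof -
  define fp fn hp hn where "fp = (\<integral>\<^sup>+ x. e2ennreal (f x) \<partial>M)" "fn = (\<integral>\<^sup>+ x. e2ennreal (- f x) \<partial>M)"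
    "hp = (\<integral>\<^sup>+ x. e2ennreal (h x) \<partial>M)" "hn = (\<integral>\<^sup>+ x. e2ennreal (- h x) \<partial>M)"
  note defs = this
  have p: "fp \<le> hp" and n: "hn \<le> fn"
    unfolding defs by (auto intro!: nn_integral_mono e2ennreal_mono simp: le)
  have fn: "fn < \<infinity>" using fin unfolding defs .
  have hn: "hn < \<infinity>" using n fn by order
  have hp: "hp < \<infinity>"
    using hfin hn unfolding ext_integral_def defs[symmetric]
    by (cases hp; cases hn) auto
  have fp: "fp < \<infinity>" using p hp by order
  have "enn2ereal hp - enn2ereal hn \<le> enn2ereal fp - enn2ereal fn"
    using ge unfolding ext_integral_def defs[symmetric] .
  with p n fn hn hp fp have "hp \<le> fp" "fn \<le> hn"
    by (cases hp; cases hn; cases fp; cases fn; simp add: enn2ereal_ennreal)+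
  have "AE x in M. e2ennreal (f x) = e2ennreal (h x)"
    using fp \<open>hp \<le> fp\<close> unfolding defs
    by (intro nn_integral_eq_imp_AE_eq) (auto intro!: e2ennreal_mono simp: le)
  moreover have "AE x in M. e2ennreal (- h x) = e2ennreal (- f x)"
    using hn \<open>fn \<le> hn\<close> unfolding defs
    by (intro nn_integral_eq_imp_AE_eq) (auto intro!: e2ennreal_mono simp: le)
  ultimately show ?thesis
  proof eventually_elim
    case (elim x)
    have pos: "enn2ereal (e2ennreal z) = max 0 z" for z
      using enn2ereal_e2ennreal[of z] e2ennreal_neg[of z] zero_ennreal.rep_eq
      by (metis linorder_linear max_absorb1 max_absorb2)
    have "max 0 (f x) = max 0 (h x)" "max 0 (- f x) = max 0 (- h x)"
      unfolding pos[symmetric] using elim by simp_all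
    then show ?case
      using le[of x] by (cases "f x"; cases "h x") (auto simp: max_def split: if_splits)
  qed
qed

lemma ext_integral_uminus_le:
  "e2ennreal (- ext_integral L f) \<le> (\<integral>\<^sup>+ x. e2ennreal (- f x) \<partial>L)"
proof -
  have "- (enn2ereal a - enn2ereal b) \<le> enn2ereal b" for a b
    by (cases a; cases b) auto
  then have "e2ennreal (- (enn2ereal a - enn2ereal b)) \<le> b" for a b
    using e2ennreal_mono[of "- (enn2ereal a - enn2ereal b)" "enn2ereal b"] by simp
  then show ?thesis unfolding ext_integral_def .
qed

section \<open>Deterministic flows and post-jump states\<close>

lemma x_flow_nonneg:
  assumes "0 < lam" "m < 2" "0 \<le> t" "0 \<le> x"
  shows "0 \<le> x_flow lam m t x"
proof (cases "lam = 1")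
  case False
  have split: "- (L / d) + E * (x + L / d) = L * ((E - 1) / d) + E * x" for L d E :: real
    by (simp add: algebra_simps diff_divide_distrib)
  \<comment> \<open>the difference quotient of the increasing function \<open>exp\<close>, times \<open>t\<close>\<close>
  have "0 \<le> (exp ((lam - 1) * t) - 1) / (lam - 1)"
    using assms False by (cases "lam < 1") (auto intro: divide_nonpos_neg divide_nonneg_pos simp: mult_nonpos_nonneg)
  then have "0 \<le> lam * (2 - m) * ((exp ((lam - 1) * t) - 1) / (lam - 1)) + exp ((lam - 1) * t) * x"
    using assms by (intro add_nonneg_nonneg mult_nonneg_nonneg) auto
  then show ?thesis
    using False split[of "lam * (2 - m)" "lam - 1" "exp ((lam - 1) * t)"] by (simp add: x_flow_def)
qed (use assms in \<open>simp add: x_flow_def\<close>)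

lemma y_flow_nonneg:
  assumes "0 < lam" "1 < m" "0 \<le> t" "0 \<le> y"
  shows "0 \<le> y_flow lam m t y"
proof (cases "lam = 2")
  case False
  have split: "- (L / d) + E * (y + L / d) = L * ((E - 1) / d) + E * y" for L d E :: real
    by (simp add: algebra_simps diff_divide_distrib)
  have "0 \<le> (exp ((lam - 2) * t) - 1) / (lam - 2)"
    using assms False by (cases "lam < 2") (auto intro: divide_nonpos_neg divide_nonneg_pos simp: mult_nonpos_nonneg)
  then have "0 \<le> lam * (m - 1) * ((exp ((lam - 2) * t) - 1) / (lam - 2)) + exp ((lam - 2) * t) * y"
    using assms by (intro add_nonneg_nonneg mult_nonneg_nonneg) auto
  then show ?thesis
    using False split[of "lam * (m - 1)" "lam - 2" "exp ((lam - 2) * t)"] by (simp add: y_flow_def)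
qed (use assms in \<open>simp add: y_flow_def\<close>)

lemma continuous_on_x_flow: "continuous_on A (\<lambda>t. x_flow lam m t x)"
  unfolding x_flow_def by (cases "lam = 1") (auto intro!: continuous_intros)

lemma continuous_on_y_flow: "continuous_on A (\<lambda>t. y_flow lam m t y)"
  unfolding y_flow_def by (cases "lam = 2") (auto intro!: continuous_intros)

lemma measurable_x_flow [measurable (raw)]:
  assumes [measurable]: "f \<in> borel_measurable M" "h \<in> borel_measurable M"
  shows "(\<lambda>\<omega>. x_flow lam m (f \<omega>) (h \<omega>)) \<in> borel_measurable M"
  unfolding x_flow_def by measurable

lemma measurable_y_flow [measurable (raw)]:
  assumes [measurable]: "f \<in> borel_measurable M" "h \<in> borel_measurable M"
  shows "(\<lambda>\<omega>. y_flow lam m (f \<omega>) (h \<omega>)) \<in> borel_measurable M"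
  unfolding y_flow_def by measurable

lemma post_jump_nonneg:
  assumes "\<And>t x. 0 \<le> t \<Longrightarrow> 0 \<le> x \<Longrightarrow> 0 \<le> flow t x"
    and "\<And>n. s n \<le> s (Suc n)" and "\<And>n. 0 \<le> a n" and "0 \<le> p"
  shows "0 \<le> post_jump flow s a p n"
  by (induction n) (auto intro!: mult_nonneg_nonneg assms)

lemma post_jump_cong:
  assumes "\<And>k. k \<le> n \<Longrightarrow> s k = s' k" and "\<And>k. 1 \<le> k \<Longrightarrow> k \<le> n \<Longrightarrow> a k = a' k"
  shows "post_jump flow s a p n = post_jump flow s' a' p n"
  using assms by (induction n) auto

lemma measurable_post_jump:
  assumes flow: "\<And>f h. f \<in> borel_measurable M \<Longrightarrow> h \<in> borel_measurable M \<Longrightarrow>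
      (\<lambda>\<omega>. flow (f \<omega>) (h \<omega>)) \<in> borel_measurable M"
    and [measurable]: "\<And>k. (\<lambda>\<omega>. s \<omega> k) \<in> borel_measurable M"
    and a: "\<And>k. 1 \<le> k \<Longrightarrow> (\<lambda>\<omega>. a \<omega> k) \<in> borel_measurable M"
  shows "(\<lambda>\<omega>. post_jump flow (s \<omega>) (a \<omega>) p n) \<in> borel_measurable M"
proof (induction n)
  case (Suc n)
  note Suc[measurable] a[of "Suc n", simplified, measurable]
  have [measurable]: "(\<lambda>\<omega>. flow (s \<omega> (Suc n) - s \<omega> n) (post_jump flow (s \<omega>) (a \<omega>) p n)) \<in> borel_measurable M"
    by (rule flow) measurable
  show ?case by simp
qed simp

text \<open>
  A continuous path on a compact interval attains its supremum, so it reaches \<open>K\<close> exactly if its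
  values at rational points come arbitrarily close to \<open>K\<close> from below or exceed it; this is a
  countable condition.
\<close>

lemma sets_Collect_continuous_path_reaches:
  fixes H :: "real \<Rightarrow> 'a \<Rightarrow> real"
  assumes meas: "\<And>u. H u \<in> borel_measurable M"
    and cont: "\<And>\<omega>. \<omega> \<in> space M \<Longrightarrow> continuous_on {0..1} (\<lambda>u. H u \<omega>)"
  shows "{\<omega> \<in> space M. \<exists>u\<in>{0..1}. K \<le> H u \<omega>} \<in> sets M"
proof -
  have "(\<exists>u\<in>{0..1}. K \<le> H u \<omega>) \<longleftrightarrow>
      (\<forall>k. \<exists>q\<in>\<rat> \<inter> {0..1}. K - 1 / real (Suc k) < H q \<omega>)" if \<omega>: "\<omega> \<in> space M" for \<omega>
  proof
    assume "\<exists>u\<in>{0..1}. K \<le> H u \<omega>"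
    then obtain u where u: "u \<in> {0..1}" "K \<le> H u \<omega>" by blast
    show "\<forall>k. \<exists>q\<in>\<rat> \<inter> {0..1}. K - 1 / real (Suc k) < H q \<omega>"
    proof
      fix k
      have "0 < 1 / real (Suc k)" by simp
      then obtain d where d: "0 < d"
        "\<And>u'. u' \<in> {0..1} \<Longrightarrow> dist u' u < d \<Longrightarrow> dist (H u' \<omega>) (H u \<omega>) < 1 / real (Suc k)"
        using cont[OF \<omega>] u(1) unfolding continuous_on_iff by meson
      have "max 0 (u - d) < min 1 (u + d)" using u(1) d(1) by auto
      then obtain q where q: "q \<in> \<rat>" "max 0 (u - d) < q" "q < min 1 (u + d)"
        using Rats_dense_in_real by blast
      then have "dist (H q \<omega>) (H u \<omega>) < 1 / real (Suc k)"
        by (intro d) (auto simp: dist_real_def)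
      then have "K - 1 / real (Suc k) < H q \<omega>"
        using u(2) unfolding dist_real_def by linarith
      then show "\<exists>q\<in>\<rat> \<inter> {0..1}. K - 1 / real (Suc k) < H q \<omega>"
        using q by (intro bexI[of _ q]) auto
    qed
  next
    assume *: "\<forall>k. \<exists>q\<in>\<rat> \<inter> {0..1}. K - 1 / real (Suc k) < H q \<omega>"
    obtain u where u: "u \<in> {0..1}" "\<And>v. v \<in> {0..1} \<Longrightarrow> H v \<omega> \<le> H u \<omega>"
      using continuous_attains_sup[of "{0..1::real}" "\<lambda>u. H u \<omega>"] cont[OF \<omega>] by auto
    have "K \<le> H u \<omega>"
    proof (rule ccontr)
      assume "\<not> K \<le> H u \<omega>"
      then obtain k where "inverse (real (Suc k)) < K - H u \<omega>"
        using reals_Archimedean[of "K - H u \<omega>"] by auto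
      moreover obtain q where "q \<in> {0..1}" "K - 1 / real (Suc k) < H q \<omega>" using * by blast
      ultimately show False using u(2)[of q] by (simp add: inverse_eq_divide)
    qed
    then show "\<exists>u\<in>{0..1}. K \<le> H u \<omega>" using u(1) by blast
  qed
  then have "{\<omega> \<in> space M. \<exists>u\<in>{0..1}. K \<le> H u \<omega>} =
      {\<omega> \<in> space M. \<forall>k. \<exists>q\<in>\<rat> \<inter> {0..1}. K - 1 / real (Suc k) < H q \<omega>}"
    by blast
  also have "\<dots> \<in> sets M"
    using meas[measurable] by (intro sets.sets_Collect_countable_All sets.sets_Collect_countable_Bex)
      (auto simp: countable_rat)
  finally show ?thesis .
qed


section \<open>Jump times and jump counts\<close>

context compound_poisson_disorder
begin

abbreviation \<sigma> :: "nat \<Rightarrow> 'a \<Rightarrow> real" where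
  "\<sigma> n \<omega> \<equiv> jump_time N n \<omega>"

text \<open>
  Right-continuity makes the infimum that defines a jump time attained. The equivalence
  trades the path of \<open>N\<close> for the sequence of its jump times.
\<close>

lemma le_N_iff_jump_time_le:
  assumes \<omega>: "\<omega> \<in> space M" and t: "0 \<le> t"
  shows "n \<le> N t \<omega> \<longleftrightarrow> \<sigma> n \<omega> \<le> t"
proof
  let ?A = "{t. 0 \<le> t \<and> n \<le> N t \<omega>}"
  have bdd: "bdd_below ?A" by (rule bdd_belowI[of _ 0]) simp
  have mono: "mono_on {0..} (\<lambda>t. N t \<omega>)"
    and rc: "\<And>t. 0 \<le> t \<Longrightarrow> continuous (at_right t) (\<lambda>s. N s \<omega>)"
    using poisson \<omega> unfolding poisson_process_def by auto
  show "\<sigma> n \<omega> \<le> t" if "n \<le> N t \<omega>"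
    unfolding jump_time_def using that t bdd by (intro cInf_lower) auto
  show "n \<le> N t \<omega>" if st: "\<sigma> n \<omega> \<le> t"
  proof -
    let ?s = "\<sigma> n \<omega>"
    have ne: "?A \<noteq> {}" using jumps_exist[OF \<omega>, of n] by auto
    have s0: "0 \<le> ?s"
      unfolding jump_time_def by (rule cInf_greatest[OF ne]) simp
    have "((\<lambda>u. N u \<omega>) \<longlongrightarrow> N ?s \<omega>) (at_right ?s)"
      using rc[OF s0] by (simp add: continuous_within)
    then have "\<forall>\<^sub>F u in at_right ?s. N u \<omega> = N ?s \<omega>"
      by (simp add: tendsto_discrete)
    then obtain b where b: "?s < b" "\<And>u. ?s < u \<Longrightarrow> u < b \<Longrightarrow> N u \<omega> = N ?s \<omega>"
      unfolding eventually_at_right_field by blast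
    obtain u where u: "u \<in> ?A" "u < b"
      using cInf_less_iff[OF ne bdd, of b] b(1) unfolding jump_time_def by auto
    have "?s \<le> u" using u(1) bdd unfolding jump_time_def by (intro cInf_lower) auto
    then have "n \<le> N ?s \<omega>"
      using b(2)[of u] u by (cases "u = ?s") auto
    also have "\<dots> \<le> N t \<omega>"
      using mono s0 st by (auto simp: mono_on_def)
    finally show ?thesis .
  qed
qed

lemma jump_time_0: "\<omega> \<in> space M \<Longrightarrow> \<sigma> 0 \<omega> = 0"
  unfolding jump_time_def by (rule cInf_eq_minimum) auto

lemma jump_time_mono:
  assumes "\<omega> \<in> space M" "i \<le> j"
  shows "\<sigma> i \<omega> \<le> \<sigma> j \<omega>"
proof (rule lift_Suc_mono_le[OF _ assms(2)])
  show "\<sigma> n \<omega> \<le> \<sigma> (Suc n) \<omega>" for n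
    by (rule less_imp_le[OF jumps_strict[OF assms(1)]])
qed

lemma jump_time_nonneg: "\<omega> \<in> space M \<Longrightarrow> 0 \<le> \<sigma> n \<omega>"
  using jump_time_mono[of \<omega> 0 n] jump_time_0 by simp

lemma N_eq_iff:
  assumes "\<omega> \<in> space M" "0 \<le> t"
  shows "N t \<omega> = n \<longleftrightarrow> \<sigma> n \<omega> \<le> t \<and> t < \<sigma> (Suc n) \<omega>"
  using le_N_iff_jump_time_le[OF assms, of n] le_N_iff_jump_time_le[OF assms, of "Suc n"] by auto

lemma N_mono: "\<omega> \<in> space M \<Longrightarrow> 0 \<le> s \<Longrightarrow> s \<le> t \<Longrightarrow> N s \<omega> \<le> N t \<omega>"
  using le_N_iff_jump_time_le[of \<omega> s "N s \<omega>"] le_N_iff_jump_time_le[of \<omega> t "N s \<omega>"] by auto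

text \<open>
  The marks are positive, so partial sums cannot cancel and every jump of \<open>N\<close> shows in \<open>X\<close>.
\<close>

lemma X_neq_iff:
  assumes "\<omega> \<in> space M" "0 \<le> s" "s \<le> t"
  shows "X s \<omega> \<noteq> X t \<omega> \<longleftrightarrow> N s \<omega> < N t \<omega>"
proof
  assume less: "N s \<omega> < N t \<omega>"
  have "X t \<omega> = X s \<omega> + (\<Sum>k = Suc (N s \<omega>)..N t \<omega>. Y k \<omega>)"
  proof -
    have "{1..N t \<omega>} = {1..N s \<omega>} \<union> {Suc (N s \<omega>)..N t \<omega>}" using less by auto
    then show ?thesis unfolding X_def by (simp add: sum.union_disjoint)
  qed
  moreover have "0 < (\<Sum>k = Suc (N s \<omega>)..N t \<omega>. Y k \<omega>) $ i" for i
    unfolding sum_component using less assms(1) by (intro sum_pos Y_pos) auto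
  ultimately show "X s \<omega> \<noteq> X t \<omega>" by (metis add_cancel_right_right less_irrefl zero_index)
next
  assume "X s \<omega> \<noteq> X t \<omega>"
  then show "N s \<omega> < N t \<omega>" using N_mono[OF assms] by (cases "N s \<omega> = N t \<omega>") (auto simp: X_def)
qed

section \<open>What the natural filtration knows\<close>

lemma measurable_Y [measurable]: "1 \<le> k \<Longrightarrow> Y k \<in> borel_measurable M"
  using Y_indep by (auto simp: indep_vars_def)

lemma measurable_N: "0 \<le> t \<Longrightarrow> N t \<in> measurable M (count_space UNIV)"
  using poisson by (simp add: poisson_process_def)

lemma measurable_jump_time [measurable]: "\<sigma> n \<in> borel_measurable M"
proof (rule borel_measurableI_le)
  fix t :: real
  show "{\<omega> \<in> space M. \<sigma> n \<omega> \<le> t} \<in> sets M"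
  proof (cases "0 \<le> t")
    case True
    note measurable_N[OF True, measurable]
    have "{\<omega> \<in> space M. \<sigma> n \<omega> \<le> t} = {\<omega> \<in> space M. n \<le> N t \<omega>}"
      using le_N_iff_jump_time_le[OF _ True] by auto
    also have "\<dots> \<in> sets M" by measurable
    finally show ?thesis .
  next
    case False
    then have "t < \<sigma> n \<omega>" if "\<omega> \<in> space M" for \<omega>
      using jump_time_nonneg[OF that, of n] by linarith
    then have "{\<omega> \<in> space M. \<sigma> n \<omega> \<le> t} = {}" by (auto simp: not_le)
    then show ?thesis by (metis sets.empty_sets)
  qed
qed

lemma measurable_X: assumes "0 \<le> t" shows "X t \<in> borel_measurable M"
proof -
  have "(\<lambda>\<omega>. (\<lambda>n \<omega>. X0 \<omega> + (\<Sum>k = 1..n. Y k \<omega>)) (N t \<omega>) \<omega>) \<in> borel_measurable M"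
    by (rule measurable_compose_countable[OF _ measurable_N[OF assms]])
      (auto intro!: borel_measurable_add borel_measurable_sum X0_measurable measurable_Y)
  then show ?thesis unfolding X_def by simp
qed

abbreviation \<F> :: "real \<Rightarrow> 'a measure" where
  "\<F> t \<equiv> natural_filtration M X (ennreal t)"

lemma space_filtration [simp]: "space (natural_filtration M X t) = space M"
  unfolding natural_filtration_def by (rule space_measure_of) auto

lemma sets_filtration: "sets (natural_filtration M X t) = sigma_sets (space M)
   {X s -` A \<inter> space M | s A. 0 \<le> s \<and> ennreal s \<le> t \<and> A \<in> sets borel}"
  unfolding natural_filtration_def by (rule sets_measure_of) auto

lemma sets_filtration_subset: "sets (natural_filtration M X t) \<subseteq> sets M"
  unfolding sets_filtration by (rule sets.sigma_sets_subset) (auto intro: measurable_sets measurable_X)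

lemma sets_filtration_mono: "s \<le> t \<Longrightarrow> sets (natural_filtration M X s) \<subseteq> sets (natural_filtration M X t)"
  unfolding sets_filtration by (rule sigma_sets_mono') (blast intro: order_trans)

lemma X_adapted: "0 \<le> s \<Longrightarrow> s \<le> t \<Longrightarrow> X s \<in> borel_measurable (\<F> t)"
  by (rule measurableI) (auto simp: sets_filtration intro!: sigma_sets.Basic ennreal_leI exI[of _ s])

text \<open>
  Induction on the number of jumps: an \<open>n\<close>-th jump is followed by another one up to time \<open>t\<close> if and
  only if \<open>X\<close> differs from \<open>X t\<close> at some rational time not before the \<open>n\<close>-th jump. Such a
  rational exists because consecutive jump times are distinct.
\<close>

lemma N_adapted: assumes "0 \<le> t" shows "N t \<in> measurable (\<F> t) (count_space UNIV)"
proof -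
  have *: "{\<omega> \<in> space M. n \<le> N t \<omega>} \<in> sets (\<F> t)" if "0 \<le> t" for n t
    using that
  proof (induction n arbitrary: t)
    case 0
    then show ?case using sets.top[of "\<F> t"] by simp
  next
    case (Suc n)
    have "Suc n \<le> N t \<omega> \<longleftrightarrow> (\<exists>s\<in>\<rat> \<inter> {0..t}. n \<le> N s \<omega> \<and> X s \<omega> \<noteq> X t \<omega>)"
      if \<omega>: "\<omega> \<in> space M" for \<omega>
    proof
      assume "Suc n \<le> N t \<omega>"
      then have le: "\<sigma> (Suc n) \<omega> \<le> t" using le_N_iff_jump_time_le[OF \<omega> Suc.prems] by blast
      obtain s where s: "s \<in> \<rat>" "\<sigma> n \<omega> < s" "s < \<sigma> (Suc n) \<omega>"
        using Rats_dense_in_real[OF jumps_strict[OF \<omega>]] by blast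
      have s0: "0 \<le> s" using s(2) jump_time_nonneg[OF \<omega>, of n] by linarith
      have "N s \<omega> = n" using N_eq_iff[OF \<omega> s0] s by auto
      then show "\<exists>s\<in>\<rat> \<inter> {0..t}. n \<le> N s \<omega> \<and> X s \<omega> \<noteq> X t \<omega>"
        using s s0 le \<open>Suc n \<le> N t \<omega>\<close> X_neq_iff[OF \<omega> s0, of t] by (intro bexI[of _ s]) auto
    next
      assume "\<exists>s\<in>\<rat> \<inter> {0..t}. n \<le> N s \<omega> \<and> X s \<omega> \<noteq> X t \<omega>"
      then show "Suc n \<le> N t \<omega>" using X_neq_iff[OF \<omega>] by fastforce
    qed
    then have "{\<omega> \<in> space M. Suc n \<le> N t \<omega>} =
        (\<Union>s\<in>\<rat> \<inter> {0..t}. {\<omega> \<in> space M. n \<le> N s \<omega>} \<inter> {\<omega> \<in> space (\<F> t). X s \<omega> \<noteq> X t \<omega>})"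
      by auto
    also have "\<dots> \<in> sets (\<F> t)"
    proof (rule sets.countable_UN'')
      fix s assume s: "s \<in> \<rat> \<inter> {0..t}"
      have [measurable]: "X s \<in> borel_measurable (\<F> t)" "X t \<in> borel_measurable (\<F> t)"
        using s by (auto intro!: X_adapted)
      have "{\<omega> \<in> space M. n \<le> N s \<omega>} \<in> sets (\<F> t)"
        using Suc.IH[of s] sets_filtration_mono[of "ennreal s" "ennreal t"] s by (auto intro: ennreal_leI)
      moreover have "{\<omega> \<in> space (\<F> t). X s \<omega> \<noteq> X t \<omega>} \<in> sets (\<F> t)" by measurable
      ultimately show "{\<omega> \<in> space M. n \<le> N s \<omega>} \<inter> {\<omega> \<in> space (\<F> t). X s \<omega> \<noteq> X t \<omega>} \<in> sets (\<F> t)"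
        by (rule sets.Int)
    qed (simp add: countable_rat)
    finally show ?case .
  qed
  show ?thesis
  proof (rule measurable_count_space_eq2_countable[THEN iffD2, rule_format])
    show "N t \<in> space (\<F> t) \<rightarrow> UNIV \<and> (\<forall>a\<in>UNIV. N t -` {a} \<inter> space (\<F> t) \<in> sets (\<F> t))"
    proof (intro conjI ballI)
      fix n
      have "N t -` {n} \<inter> space (\<F> t) = {\<omega> \<in> space M. n \<le> N t \<omega>} - {\<omega> \<in> space M. Suc n \<le> N t \<omega>}"
        by auto
      then show "N t -` {n} \<inter> space (\<F> t) \<in> sets (\<F> t)" using *[OF assms] by auto
    qed simp
  qed
qed

lemma N_adapted_later: "0 \<le> s \<Longrightarrow> s \<le> t \<Longrightarrow> N s \<in> measurable (\<F> t) (count_space UNIV)"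
  using measurable_mono[of "count_space UNIV" "count_space UNIV" "\<F> s" "\<F> t"] sets_filtration_mono[of "ennreal s" "ennreal t"]
    N_adapted[of s] by (auto intro: ennreal_leI)

lemma stopped_jump_time_adapted: assumes "0 \<le> t" shows "(\<lambda>\<omega>. min (\<sigma> n \<omega>) t) \<in> borel_measurable (\<F> t)"
proof (rule borel_measurableI_le)
  fix y
  consider "t \<le> y" | "y < 0" | "0 \<le> y" "y < t" by linarith
  then show "{\<omega> \<in> space (\<F> t). min (\<sigma> n \<omega>) t \<le> y} \<in> sets (\<F> t)"
  proof cases
    case 1
    then have "{\<omega> \<in> space (\<F> t). min (\<sigma> n \<omega>) t \<le> y} = space (\<F> t)" by auto
    then show ?thesis by (metis sets.top)
  next
    case 2
    then have "y < min (\<sigma> n \<omega>) t" if "\<omega> \<in> space M" for \<omega>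
      using jump_time_nonneg[OF that, of n] assms by linarith
    then have "{\<omega> \<in> space (\<F> t). min (\<sigma> n \<omega>) t \<le> y} = {}" by (auto simp: not_le)
    then show ?thesis by (metis sets.empty_sets)
  next
    case 3
    then have [measurable]: "N y \<in> measurable (\<F> t) (count_space UNIV)" by (intro N_adapted_later) auto
    have "{\<omega> \<in> space (\<F> t). min (\<sigma> n \<omega>) t \<le> y} = {\<omega> \<in> space (\<F> t). n \<le> N y \<omega>}"
      using 3 by (auto simp: min_le_iff_disj le_N_iff_jump_time_le)
    also have "\<dots> \<in> sets (\<F> t)" by measurable
    finally show ?thesis .
  qed
qed

text \<open>
  The sum of the first \<open>k\<close> marks is the value of \<open>X\<close> while \<open>N = k\<close>. That period either
  still lasts at time \<open>t\<close> or is a nondegenerate interval before \<open>t\<close>, which contains a rational, so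
  countably many observation times suffice to read off the value. The default value \<open>0\<close> covers
  the paths with fewer than \<open>k\<close> jumps up to \<open>t\<close>.
\<close>

lemma partial_sum_adapted:
  assumes "0 \<le> t"
  shows "(\<lambda>\<omega>. if k \<le> N t \<omega> then X0 \<omega> + (\<Sum>i = 1..k. Y i \<omega>) else 0) \<in> borel_measurable (\<F> t)"
    (is "?f \<in> _")
proof (rule measurableI)
  fix A :: "(real ^ 'd) set" assume A: "A \<in> sets borel"
  define Q where "Q = insert t (\<rat> \<inter> {0..t})"
  let ?Z = "\<lambda>\<omega>. X0 \<omega> + (\<Sum>i = 1..k. Y i \<omega>)"
  have "k \<le> N t \<omega> \<and> ?Z \<omega> \<in> A \<longleftrightarrow> (\<exists>s\<in>Q. N s \<omega> = k \<and> X s \<omega> \<in> A)"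
    if \<omega>: "\<omega> \<in> space M" for \<omega>
  proof
    assume k: "k \<le> N t \<omega> \<and> ?Z \<omega> \<in> A"
    have "\<exists>s\<in>Q. N s \<omega> = k"
    proof (cases "N t \<omega> = k")
      case False
      then have "\<sigma> (Suc k) \<omega> \<le> t" using k le_N_iff_jump_time_le[OF \<omega> assms, of "Suc k"] by auto
      obtain s where s: "s \<in> \<rat>" "\<sigma> k \<omega> < s" "s < \<sigma> (Suc k) \<omega>"
        using Rats_dense_in_real[OF jumps_strict[OF \<omega>]] by blast
      have s0: "0 \<le> s" using s(2) jump_time_nonneg[OF \<omega>, of k] by linarith
      then show ?thesis unfolding Q_def using N_eq_iff[OF \<omega> s0] s \<open>\<sigma> (Suc k) \<omega> \<le> t\<close> by (intro bexI[of _ s]) auto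
    qed (auto simp: Q_def)
    then show "\<exists>s\<in>Q. N s \<omega> = k \<and> X s \<omega> \<in> A" using k unfolding X_def by blast
  next
    assume "\<exists>s\<in>Q. N s \<omega> = k \<and> X s \<omega> \<in> A"
    then show "k \<le> N t \<omega> \<and> ?Z \<omega> \<in> A"
      using N_mono[OF \<omega>] assms unfolding X_def Q_def by fastforce
  qed
  then have "{\<omega> \<in> space M. k \<le> N t \<omega> \<and> ?Z \<omega> \<in> A} = (\<Union>s\<in>Q. {\<omega> \<in> space (\<F> t). N s \<omega> = k \<and> X s \<omega> \<in> A})"
    by auto
  moreover have "?f -` A \<inter> space (\<F> t) =
      {\<omega> \<in> space M. k \<le> N t \<omega> \<and> ?Z \<omega> \<in> A} \<union> {\<omega> \<in> space (\<F> t). N t \<omega> < k \<and> 0 \<in> A}"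
    by (auto split: if_splits simp: not_le)
  ultimately have "?f -` A \<inter> space (\<F> t) =
      (\<Union>s\<in>Q. {\<omega> \<in> space (\<F> t). N s \<omega> = k \<and> X s \<omega> \<in> A}) \<union> {\<omega> \<in> space (\<F> t). N t \<omega> < k \<and> 0 \<in> A}"
    by simp
  also have "\<dots> \<in> sets (\<F> t)"
  proof (intro sets.Un sets.countable_UN'')
    fix s assume s: "s \<in> Q"
    have [measurable]: "N s \<in> measurable (\<F> t) (count_space UNIV)" "X s \<in> borel_measurable (\<F> t)"
      using s assms by (auto simp: Q_def intro!: N_adapted_later X_adapted)
    show "{\<omega> \<in> space (\<F> t). N s \<omega> = k \<and> X s \<omega> \<in> A} \<in> sets (\<F> t)" using A by measurable
  next
    note N_adapted[OF assms, measurable]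
    show "{\<omega> \<in> space (\<F> t). N t \<omega> < k \<and> 0 \<in> A} \<in> sets (\<F> t)" by measurable
  qed (simp add: Q_def countable_rat)
  finally show "?f -` A \<inter> space (\<F> t) \<in> sets (\<F> t)" .
qed simp

lemma mark_adapted:
  assumes t: "0 \<le> t" and k: "1 \<le> k"
  shows "(\<lambda>\<omega>. if k \<le> N t \<omega> then Y k \<omega> else 0) \<in> borel_measurable (\<F> t)"
proof -
  let ?Z = "\<lambda>k \<omega>. if k \<le> N t \<omega> then X0 \<omega> + (\<Sum>i = 1..k. Y i \<omega>) else 0"
  note partial_sum_adapted[OF t, measurable] N_adapted[OF t, measurable]
  have "(\<lambda>\<omega>. if k \<le> N t \<omega> then ?Z k \<omega> - ?Z (k - 1) \<omega> else 0) \<in> borel_measurable (\<F> t)"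
    by measurable
  also have "(\<lambda>\<omega>. if k \<le> N t \<omega> then ?Z k \<omega> - ?Z (k - 1) \<omega> else 0) = (\<lambda>\<omega>. if k \<le> N t \<omega> then Y k \<omega> else 0)"
    using k by (cases k) (auto simp: fun_eq_iff)
  finally show ?thesis .
qed

section \<open>The first time the level is reached is a stopping time\<close>

definition post_jump_state :: "(real \<Rightarrow> real \<Rightarrow> real) \<Rightarrow> real \<Rightarrow> real \<Rightarrow> nat \<Rightarrow> 'a \<Rightarrow> real" where
  "post_jump_state flow b p n \<omega> =
     post_jump flow (\<lambda>n. \<sigma> n \<omega>) (\<lambda>n. b * r (Y n \<omega>)) p n"

definition last_jump :: "real \<Rightarrow> 'a \<Rightarrow> real" where
  "last_jump t \<omega> = \<sigma> (N t \<omega>) \<omega>"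

text \<open>
  The value of \<open>\<Phi>0 + \<Phi>1\<close> that the flow produces at time \<open>u\<close> after the \<open>n\<close>-th jump if no further
  jump intervenes. Unlike \<open>\<Phi>0 + \<Phi>1\<close> itself it is continuous in \<open>u\<close>.
\<close>

definition flowed_sum :: "real \<Rightarrow> real \<Rightarrow> nat \<Rightarrow> real \<Rightarrow> 'a \<Rightarrow> real" where
  "flowed_sum \<phi>0 \<phi>1 n u \<omega> =
     x_flow lam m u (post_jump_state (x_flow lam m) (1 + 1 / \<mu>) \<phi>0 n \<omega>) +
     y_flow lam m u (post_jump_state (y_flow lam m) (1 + 2 / \<mu>) \<phi>1 n \<omega>)"

lemma Phi_sum_eq: "Phi0 \<phi>0 t \<omega> + Phi1 \<phi>1 t \<omega> = flowed_sum \<phi>0 \<phi>1 (N t \<omega>) (t - \<sigma> (N t \<omega>) \<omega>) \<omega>"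
  unfolding Phi0_def Phi1_def flowed_sum_def post_jump_state_def ..

text \<open>
  The state after the last jump depends on the first \<open>N t\<close> jump times and marks only. Truncating the
  jump times at \<open>t\<close> and setting later marks to \<open>0\<close> therefore leaves it unchanged, and the truncated
  data are known at time \<open>t\<close>.
\<close>

lemma post_jump_state_adapted:
  assumes t: "0 \<le> t"
    and flow: "\<And>f h. f \<in> borel_measurable (\<F> t) \<Longrightarrow> h \<in> borel_measurable (\<F> t) \<Longrightarrow>
      (\<lambda>\<omega>. flow (f \<omega>) (h \<omega>)) \<in> borel_measurable (\<F> t)"
  shows "(\<lambda>\<omega>. post_jump_state flow b p (N t \<omega>) \<omega>) \<in> borel_measurable (\<F> t)"
proof -
  note mark_adapted[OF t, measurable] stopped_jump_time_adapted[OF t, measurable] r_measurable[measurable]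
  let ?P = "\<lambda>n \<omega>. post_jump flow (\<lambda>k. min (\<sigma> k \<omega>) t) (\<lambda>k. b * r (if k \<le> N t \<omega> then Y k \<omega> else 0)) p n"
  have "(\<lambda>\<omega>. ?P (N t \<omega>) \<omega>) \<in> borel_measurable (\<F> t)"
    by (rule measurable_compose_countable[OF _ N_adapted[OF t]]) (rule measurable_post_jump[OF flow]; measurable)
  moreover have "?P (N t \<omega>) \<omega> = post_jump_state flow b p (N t \<omega>) \<omega>" if "\<omega> \<in> space M" for \<omega>
    unfolding post_jump_state_def using le_N_iff_jump_time_le[OF that t]
    by (intro post_jump_cong) (auto simp: min_def)
  ultimately show ?thesis by (subst measurable_cong[symmetric]) auto
qed

lemma last_jump_adapted: assumes t: "0 \<le> t" shows "last_jump t \<in> borel_measurable (\<F> t)"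
proof -
  have "(\<lambda>\<omega>. (\<lambda>n \<omega>. min (\<sigma> n \<omega>) t) (N t \<omega>) \<omega>) \<in> borel_measurable (\<F> t)"
    by (rule measurable_compose_countable[OF stopped_jump_time_adapted[OF t] N_adapted[OF t]])
  moreover have "min (\<sigma> (N t \<omega>) \<omega>) t = last_jump t \<omega>" if "\<omega> \<in> space M" for \<omega>
    unfolding last_jump_def using le_N_iff_jump_time_le[OF that t, of "N t \<omega>"] by auto
  ultimately show ?thesis by (subst measurable_cong[symmetric]) auto
qed

text \<open>
  The interval from the last jump to \<open>t\<close> depends on the path; \<open>u\<close> rescales it to \<open>[0, 1]\<close>, so that
  the same countable set of parameters serves every path.
\<close>

lemma reached_since_last_jump_adapted:
  assumes t: "0 \<le> t"
  shows "{\<omega> \<in> space M. \<exists>u\<in>{0..1}. K \<le> flowed_sum \<phi>0 \<phi>1 (N t \<omega>) (u * (t - last_jump t \<omega>)) \<omega>} \<in> sets (\<F> t)"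
proof -
  note last_jump_adapted[OF t, measurable]
  have [measurable]:
    "(\<lambda>\<omega>. post_jump_state (x_flow lam m) b p (N t \<omega>) \<omega>) \<in> borel_measurable (\<F> t)" for b p
    by (rule post_jump_state_adapted[OF t]) (rule measurable_x_flow)
  have [measurable]:
    "(\<lambda>\<omega>. post_jump_state (y_flow lam m) b p (N t \<omega>) \<omega>) \<in> borel_measurable (\<F> t)" for b p
    by (rule post_jump_state_adapted[OF t]) (rule measurable_y_flow)
  have "continuous_on {0..1} (\<lambda>u. flowed_sum \<phi>0 \<phi>1 n (u * v) \<omega>)" for n v \<omega>
    unfolding flowed_sum_def
    by (intro continuous_on_add continuous_on_compose2[OF continuous_on_x_flow[of UNIV]]
        continuous_on_compose2[OF continuous_on_y_flow[of UNIV]] continuous_intros) auto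
  moreover have "(\<lambda>\<omega>. flowed_sum \<phi>0 \<phi>1 (N t \<omega>) (u * (t - last_jump t \<omega>)) \<omega>) \<in> borel_measurable (\<F> t)" for u
    unfolding flowed_sum_def by measurable
  ultimately show ?thesis
    using sets_Collect_continuous_path_reaches[of "\<lambda>u \<omega>. flowed_sum \<phi>0 \<phi>1 (N t \<omega>) (u * (t - last_jump t \<omega>)) \<omega>" "\<F> t" K]
    by simp
qed

text \<open>
  If the sum stays below the level on \<open>[0, t]\<close>, then by continuity of the flow and because no
  jump follows immediately after \<open>t\<close>, it stays below for a positive time longer. Hence the infimum
  cannot equal \<open>t\<close> without being attained.
\<close>

lemma tau_l_le_iff:
  assumes \<omega>: "\<omega> \<in> space M" and t: "0 \<le> t"
  shows "tau_l \<phi>0 \<phi>1 \<omega> \<le> ennreal t \<longleftrightarrow> (\<exists>s\<in>{0..t}. lam / c \<le> Phi0 \<phi>0 s \<omega> + Phi1 \<phi>1 s \<omega>)"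
proof
  assume "\<exists>s\<in>{0..t}. lam / c \<le> Phi0 \<phi>0 s \<omega> + Phi1 \<phi>1 s \<omega>"
  then obtain s where s: "0 \<le> s" "s \<le> t" "lam / c \<le> Phi0 \<phi>0 s \<omega> + Phi1 \<phi>1 s \<omega>" by auto
  then have "tau_l \<phi>0 \<phi>1 \<omega> \<le> ennreal s"
    unfolding tau_l_def by (intro Inf_lower) auto
  also have "\<dots> \<le> ennreal t" using s by (intro ennreal_leI)
  finally show "tau_l \<phi>0 \<phi>1 \<omega> \<le> ennreal t" .
next
  assume le: "tau_l \<phi>0 \<phi>1 \<omega> \<le> ennreal t"
  show "\<exists>s\<in>{0..t}. lam / c \<le> Phi0 \<phi>0 s \<omega> + Phi1 \<phi>1 s \<omega>"
  proof (rule ccontr)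
    assume "\<not> ?thesis"
    then have below: "Phi0 \<phi>0 s \<omega> + Phi1 \<phi>1 s \<omega> < lam / c" if "0 \<le> s" "s \<le> t" for s
      using that by force
    let ?n = "N t \<omega>"
    have n: "\<sigma> ?n \<omega> \<le> t" "t < \<sigma> (Suc ?n) \<omega>" using N_eq_iff[OF \<omega> t] by auto
    let ?f = "\<lambda>s. flowed_sum \<phi>0 \<phi>1 ?n (s - \<sigma> ?n \<omega>) \<omega>"
    have "continuous_on UNIV ?f"
      unfolding flowed_sum_def
      by (intro continuous_on_add continuous_on_compose2[OF continuous_on_x_flow[of UNIV]]
        continuous_on_compose2[OF continuous_on_y_flow[of UNIV]] continuous_intros) auto
    then have "(?f \<longlongrightarrow> ?f t) (at_right t)"
      by (auto simp: continuous_on_def intro: tendsto_within_subset)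
    moreover have "?f t < lam / c" using below[of t] t by (simp add: Phi_sum_eq)
    ultimately have "\<forall>\<^sub>F s in at_right t. ?f s < lam / c" by (rule order_tendstoD)
    then obtain b where b: "t < b" "\<And>s. t < s \<Longrightarrow> s < b \<Longrightarrow> ?f s < lam / c"
      unfolding eventually_at_right_field by blast
    let ?b = "min b (\<sigma> (Suc ?n) \<omega>)"
    have "ennreal ?b \<le> tau_l \<phi>0 \<phi>1 \<omega>"
      unfolding tau_l_def
    proof (rule Inf_greatest, clarify)
      fix s assume s: "0 \<le> s" "lam / c \<le> Phi0 \<phi>0 s \<omega> + Phi1 \<phi>1 s \<omega>"
      have "?b \<le> s"
      proof (rule ccontr)
        assume "\<not> ?b \<le> s"
        then have sb: "s < b" "s < \<sigma> (Suc ?n) \<omega>" by auto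
        have ts: "t < s" using below[of s] s by force
        then have "N s \<omega> = ?n" using N_eq_iff[OF \<omega> s(1)] n sb by auto
        then show False using b(2)[OF ts sb(1)] s(2) by (simp add: Phi_sum_eq)
      qed
      then show "ennreal ?b \<le> ennreal s" by (rule ennreal_leI)
    qed
    then have "ennreal ?b \<le> ennreal t" using le by order
    then have "?b \<le> t" using t by simp
    then show False using b(1) n(2) by auto
  qed
qed

text \<open>
  If the level is reached at \<open>s < t\<close>, then some rational \<open>v\<close> between \<open>s\<close> and \<open>t\<close> precedes the next
  jump, and the event is seen on the stretch from the last jump before \<open>v\<close> to \<open>v\<close>. The case
  \<open>s = t\<close> is why \<open>t\<close> itself is added to the rationals.
\<close>

lemma tau_l_stopping_time: "stopping_time (natural_filtration M X) (tau_l \<phi>0 \<phi>1)"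
proof
  fix T :: ennreal
  show "Measurable.pred (natural_filtration M X T) (\<lambda>\<omega>. tau_l \<phi>0 \<phi>1 \<omega> \<le> T)"
  proof (cases T)
    case top
    then show ?thesis by simp
  next
    case (real t)
    then have t: "0 \<le> t" and T: "T = ennreal t" by auto
    define Q where "Q = insert t (\<rat> \<inter> {0..t})"
    define E where "E v = {\<omega> \<in> space M. \<exists>u\<in>{0..1}. lam / c \<le> flowed_sum \<phi>0 \<phi>1 (N v \<omega>) (u * (v - last_jump v \<omega>)) \<omega>}" for v
    have E_space: "E v \<subseteq> space M" for v unfolding E_def by blast
    have "(\<exists>s\<in>{0..t}. lam / c \<le> Phi0 \<phi>0 s \<omega> + Phi1 \<phi>1 s \<omega>) \<longleftrightarrow> (\<exists>v\<in>Q. \<omega> \<in> E v)"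
      if \<omega>: "\<omega> \<in> space M" for \<omega>
    proof
      assume "\<exists>s\<in>{0..t}. lam / c \<le> Phi0 \<phi>0 s \<omega> + Phi1 \<phi>1 s \<omega>"
      then obtain s where s: "0 \<le> s" "s \<le> t" "lam / c \<le> Phi0 \<phi>0 s \<omega> + Phi1 \<phi>1 s \<omega>" by auto
      let ?n = "N s \<omega>"
      have n: "\<sigma> ?n \<omega> \<le> s" "s < \<sigma> (Suc ?n) \<omega>" using N_eq_iff[OF \<omega> s(1)] by auto
      have "\<exists>v\<in>Q. s \<le> v \<and> v < \<sigma> (Suc ?n) \<omega>"
      proof (cases "s = t")
        case False
        then have "s < min t (\<sigma> (Suc ?n) \<omega>)" using n s by auto
        then obtain v where "v \<in> \<rat>" "s < v" "v < min t (\<sigma> (Suc ?n) \<omega>)"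
          using Rats_dense_in_real by blast
        then show ?thesis using s by (intro bexI[of _ v]) (auto simp: Q_def)
      qed (use n in \<open>auto simp: Q_def\<close>)
      then obtain v where v: "v \<in> Q" "s \<le> v" "v < \<sigma> (Suc ?n) \<omega>" by blast
      have Nv: "N v \<omega> = ?n" using N_eq_iff[OF \<omega>, of v] v n s by auto
      \<comment> \<open>the interval degenerates to a point when \<open>v\<close> is itself the jump time\<close>
      define u where "u = (if v = \<sigma> ?n \<omega> then 0 else (s - \<sigma> ?n \<omega>) / (v - \<sigma> ?n \<omega>))"
      have "u \<in> {0..1}" "u * (v - \<sigma> ?n \<omega>) = s - \<sigma> ?n \<omega>"
        using v n by (auto simp: u_def divide_simps)
      then have "\<omega> \<in> E v"
        using s(3) \<omega> by (auto simp: E_def Phi_sum_eq last_jump_def Nv intro!: bexI[of _ u])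
      then show "\<exists>v\<in>Q. \<omega> \<in> E v" using v by blast
    next
      assume "\<exists>v\<in>Q. \<omega> \<in> E v"
      then obtain v where v: "v \<in> Q" "\<omega> \<in> E v" by blast
      then obtain u where u: "u \<in> {0..1}"
        "lam / c \<le> flowed_sum \<phi>0 \<phi>1 (N v \<omega>) (u * (v - last_jump v \<omega>)) \<omega>" by (auto simp: E_def)
      have v0: "0 \<le> v" "v \<le> t" using v t by (auto simp: Q_def)
      let ?n = "N v \<omega>"
      have n: "\<sigma> ?n \<omega> \<le> v" "v < \<sigma> (Suc ?n) \<omega>" using N_eq_iff[OF \<omega> v0(1)] by auto
      define s where "s = \<sigma> ?n \<omega> + u * (v - \<sigma> ?n \<omega>)"
      have s: "\<sigma> ?n \<omega> \<le> s" "s \<le> v"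
        using u(1) n mult_left_le_one_le[of "v - \<sigma> ?n \<omega>" u] by (auto simp: s_def)
      have s0: "0 \<le> s" using s jump_time_nonneg[OF \<omega>, of ?n] by linarith
      have "N s \<omega> = ?n" using N_eq_iff[OF \<omega> s0] s n by auto
      then have "lam / c \<le> Phi0 \<phi>0 s \<omega> + Phi1 \<phi>1 s \<omega>"
        using u(2) by (simp add: Phi_sum_eq last_jump_def s_def)
      then show "\<exists>s\<in>{0..t}. lam / c \<le> Phi0 \<phi>0 s \<omega> + Phi1 \<phi>1 s \<omega>"
        using s0 s v0 by (intro bexI[of _ s]) auto
    qed
    then have "{\<omega> \<in> space (\<F> t). tau_l \<phi>0 \<phi>1 \<omega> \<le> ennreal t} = (\<Union>v\<in>Q. E v)"
      using tau_l_le_iff[OF _ t] E_space by fastforce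
    also have "\<dots> \<in> sets (\<F> t)"
    proof (rule sets.countable_UN'')
      fix v assume "v \<in> Q"
      then have "0 \<le> v" "v \<le> t" using t by (auto simp: Q_def)
      then show "E v \<in> sets (\<F> t)"
        using reached_since_last_jump_adapted[of v] sets_filtration_mono[of "ennreal v" "ennreal t"]
        by (auto simp: E_def intro: ennreal_leI)
    qed (simp add: Q_def countable_rat)
    finally show ?thesis unfolding T pred_def by simp
  qed
qed

lemma stopping_time_measurable:
  assumes "stopping_time (natural_filtration M X) \<tau>"
  shows "\<tau> \<in> borel_measurable M"
proof (rule borel_measurableI_le)
  fix t
  have "{\<omega> \<in> space M. \<tau> \<omega> \<le> t} \<in> sets (natural_filtration M X t)"
    using stopping_timeD[OF assms, of t] by (simp add: pred_def)
  then show "{\<omega> \<in> space M. \<tau> \<omega> \<le> t} \<in> sets M" using sets_filtration_subset by blast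
qed

section \<open>Comparison of costs\<close>

definition running_cost :: "real \<Rightarrow> real \<Rightarrow> ('a \<Rightarrow> ennreal) \<Rightarrow> 'a \<Rightarrow> real \<Rightarrow> ereal" where
  "running_cost \<phi>0 \<phi>1 \<tau> \<omega> t = ereal (indicator {t. 0 \<le> t \<and> ennreal t < \<tau> \<omega>} t *
     (exp (- lam * t) * g (Phi0 \<phi>0 t \<omega>) (Phi1 \<phi>1 t \<omega>)))"

lemma expected_cost_eq: "expected_cost \<phi>0 \<phi>1 \<tau> =
    ext_integral M (\<lambda>\<omega>. ext_integral lborel (running_cost \<phi>0 \<phi>1 \<tau> \<omega>))"
  unfolding expected_cost_def running_cost_def ..

text \<open>
  The process \<open>N\<close> is indexed by all reals but constrained at nonnegative times only, so it is
  evaluated at \<open>max 0 t\<close>; the indicator removes the difference.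
\<close>

lemma measurable_running_cost:
  assumes [measurable]: "\<tau> \<in> borel_measurable M"
  shows "(\<lambda>(\<omega>, t). running_cost \<phi>0 \<phi>1 \<tau> \<omega> t) \<in> borel_measurable (M \<Otimes>\<^sub>M lborel)"
proof -
  let ?M = "M \<Otimes>\<^sub>M (lborel :: real measure)"
  let ?N = "\<lambda>p. N (max 0 (snd p)) (fst p)"
  have N: "?N \<in> measurable ?M (count_space UNIV)"
  proof (rule measurable_count_space_eq2_countable[THEN iffD2, rule_format])
    show "?N \<in> space ?M \<rightarrow> UNIV \<and> (\<forall>a\<in>UNIV. ?N -` {a} \<inter> space ?M \<in> sets ?M)"
    proof (intro conjI ballI)
      fix n
      have iff: "?N p = n \<longleftrightarrow> \<sigma> n (fst p) \<le> max 0 (snd p) \<and> max 0 (snd p) < \<sigma> (Suc n) (fst p)"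
        if "p \<in> space ?M" for p
        using that by (intro N_eq_iff) (auto simp: space_pair_measure)
      have "?N -` {n} \<inter> space ?M =
         {p \<in> space ?M. \<sigma> n (fst p) \<le> max 0 (snd p) \<and> max 0 (snd p) < \<sigma> (Suc n) (fst p)}"
        using iff by blast
      also have "\<dots> \<in> sets ?M" by measurable
      finally show "?N -` {n} \<inter> space ?M \<in> sets ?M" .
    qed simp
  qed
  note r_measurable[measurable]
  have state: "(\<lambda>\<omega>. post_jump_state flow b p n \<omega>) \<in> borel_measurable M"
    if "\<And>f h. f \<in> borel_measurable M \<Longrightarrow> h \<in> borel_measurable M \<Longrightarrow>
      (\<lambda>\<omega>. flow (f \<omega>) (h \<omega>)) \<in> borel_measurable M" for flow b p n
    unfolding post_jump_state_def by (rule measurable_post_jump[OF that]; measurable)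
  have [measurable]:
    "post_jump_state (x_flow lam m) b p n \<in> borel_measurable M"
    "post_jump_state (y_flow lam m) b p n \<in> borel_measurable M" for b p n
    by (rule state, erule (1) measurable_x_flow) (rule state, erule (1) measurable_y_flow)
  have [measurable]: "(\<lambda>p. (\<lambda>n p. flowed_sum \<phi>0 \<phi>1 n (snd p - \<sigma> n (fst p)) (fst p)) (?N p) p) \<in> borel_measurable ?M"
    by (rule measurable_compose_countable[OF _ N]) (unfold flowed_sum_def, measurable)
  have "(\<lambda>p. ereal (if 0 \<le> snd p \<and> ennreal (snd p) < \<tau> (fst p)
      then exp (- lam * snd p) * (flowed_sum \<phi>0 \<phi>1 (?N p) (snd p - \<sigma> (?N p) (fst p)) (fst p) - lam / c) else 0))
    \<in> borel_measurable ?M"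
    by measurable
  also have "(\<lambda>p. ereal (if 0 \<le> snd p \<and> ennreal (snd p) < \<tau> (fst p)
      then exp (- lam * snd p) * (flowed_sum \<phi>0 \<phi>1 (?N p) (snd p - \<sigma> (?N p) (fst p)) (fst p) - lam / c) else 0)) =
      (\<lambda>(\<omega>, t). running_cost \<phi>0 \<phi>1 \<tau> \<omega> t)"
    by (auto simp: fun_eq_iff running_cost_def g_def Phi_sum_eq)
  finally show ?thesis .
qed

lemma Phi_nonneg:
  assumes "\<omega> \<in> space M" "0 \<le> t" "0 \<le> \<phi>0" "0 \<le> \<phi>1"
  shows "0 \<le> Phi0 \<phi>0 t \<omega>" and "0 \<le> Phi1 \<phi>1 t \<omega>"
proof -
  have "0 \<le> t - \<sigma> (N t \<omega>) \<omega>" using N_eq_iff[of \<omega> t "N t \<omega>"] assms by auto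
  then show "0 \<le> Phi0 \<phi>0 t \<omega>" "0 \<le> Phi1 \<phi>1 t \<omega>"
    unfolding Phi0_def Phi1_def using assms lam_pos m_range \<mu>_pos r_nonneg
    by (auto intro!: x_flow_nonneg y_flow_nonneg post_jump_nonneg mult_nonneg_nonneg less_imp_le[OF jumps_strict])
qed

text \<open>
  The integrand is \<open>1/c\<close> times the density of the exponential distribution with rate \<open>\<lambda>\<close>.
\<close>

lemma nn_integral_discount: "(\<integral>\<^sup>+ t. ennreal (indicator {0..} t * (exp (- lam * t) * (lam / c))) \<partial>lborel) = ennreal (1 / c)"
proof -
  have "(\<integral>\<^sup>+ t. ennreal (indicator {0..} t * (exp (- lam * t) * (lam / c))) \<partial>lborel) =
    (\<integral>\<^sup>+ t. ennreal (exponential_density lam t) * ennreal (1 / c) \<partial>lborel)"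
    using lam_pos c_pos
    by (intro nn_integral_cong)
      (auto simp: exponential_density_def ennreal_mult[symmetric] indicator_def split: if_splits)
  also have "\<dots> = (\<integral>\<^sup>+ t. ennreal (exponential_density lam t) \<partial>lborel) * ennreal (1 / c)"
    by (rule nn_integral_multc) simp
  also have "(\<integral>\<^sup>+ t. ennreal (exponential_density lam t) \<partial>lborel) = 1"
    using prob_space.emeasure_space_1[OF prob_space_exponential_density[OF lam_pos]]
    by (simp add: emeasure_density)
  finally show ?thesis by simp
qed

text \<open>
  The processes \<open>\<Phi>0\<close> and \<open>\<Phi>1\<close> are nonnegative, so \<open>g \<ge> -\<lambda>/c\<close>.
\<close>

lemma running_cost_negative_part:
  assumes "\<omega> \<in> space M" "0 \<le> \<phi>0" "0 \<le> \<phi>1"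
  shows "(\<integral>\<^sup>+ t. e2ennreal (- running_cost \<phi>0 \<phi>1 \<tau> \<omega> t) \<partial>lborel) \<le> ennreal (1 / c)"
proof -
  have "(\<integral>\<^sup>+ t. e2ennreal (- running_cost \<phi>0 \<phi>1 \<tau> \<omega> t) \<partial>lborel) \<le>
    (\<integral>\<^sup>+ t. ennreal (indicator {0..} t * (exp (- lam * t) * (lam / c))) \<partial>lborel)"
  proof (rule nn_integral_mono)
    fix t
    have "- (indicator {t. 0 \<le> t \<and> ennreal t < \<tau> \<omega>} t *
     (exp (- lam * t) * g (Phi0 \<phi>0 t \<omega>) (Phi1 \<phi>1 t \<omega>))) \<le> indicator {0..} t * (exp (- lam * t) * (lam / c))"
    proof (cases "0 \<le> t \<and> ennreal t < \<tau> \<omega>")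
      case True
      then have "- g (Phi0 \<phi>0 t \<omega>) (Phi1 \<phi>1 t \<omega>) \<le> lam / c"
        using Phi_nonneg[OF assms(1) _ assms(2,3), of t] unfolding g_def by linarith
      then have "exp (- lam * t) * - g (Phi0 \<phi>0 t \<omega>) (Phi1 \<phi>1 t \<omega>) \<le> exp (- lam * t) * (lam / c)"
        by (rule mult_left_mono) simp
      then show ?thesis using True by (simp add: indicator_def)
    next
      case False
      then show ?thesis using lam_pos c_pos by (simp add: indicator_def)
    qed
    then show "e2ennreal (- running_cost \<phi>0 \<phi>1 \<tau> \<omega> t) \<le> ennreal (indicator {0..} t * (exp (- lam * t) * (lam / c)))"
      unfolding running_cost_def uminus_ereal.simps e2ennreal_ereal by (rule ennreal_leI)
  qed
  also have "\<dots> = ennreal (1 / c)" by (rule nn_integral_discount)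
  finally show ?thesis .
qed

lemma measurable_ext_integral_running_cost:
  assumes "\<tau> \<in> borel_measurable M"
  shows "(\<lambda>\<omega>. ext_integral lborel (running_cost \<phi>0 \<phi>1 \<tau> \<omega>)) \<in> borel_measurable M"
proof -
  note measurable_running_cost[OF assms, measurable]
  have [measurable]: "(\<lambda>\<omega>. \<integral>\<^sup>+ t. e2ennreal (running_cost \<phi>0 \<phi>1 \<tau> \<omega> t) \<partial>lborel) \<in> borel_measurable M"
    "(\<lambda>\<omega>. \<integral>\<^sup>+ t. e2ennreal (- running_cost \<phi>0 \<phi>1 \<tau> \<omega> t) \<partial>lborel) \<in> borel_measurable M"
    by (rule sigma_finite_measure.borel_measurable_nn_integral[OF sigma_finite_lborel]; measurable)+
  show ?thesis unfolding ext_integral_def by measurable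
qed

text \<open>
  A positive probability of \<open>\<tau> < \<tau>\<^sup>l\<close> would make \<open>max \<tau> \<tau>\<^sup>l\<close> strictly cheaper than \<open>\<tau>\<close>.
\<close>

lemma tau_l_le_optimal:
  assumes \<phi>: "0 \<le> \<phi>0" "0 \<le> \<phi>1" and opt: "optimal \<phi>0 \<phi>1 \<tau>"
  shows "AE \<omega> in M. tau_l \<phi>0 \<phi>1 \<omega> \<le> \<tau> \<omega>"
proof -
  let ?\<rho> = "\<lambda>\<omega>. max (\<tau> \<omega>) (tau_l \<phi>0 \<phi>1 \<omega>)"
  let ?J = "\<lambda>\<tau> \<omega>. ext_integral lborel (running_cost \<phi>0 \<phi>1 \<tau> \<omega>)"
  have \<tau>: "stopping_time (natural_filtration M X) \<tau>"
    and V: "expected_cost \<phi>0 \<phi>1 \<tau> = V \<phi>0 \<phi>1"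
    using opt by (auto simp: optimal_def stopping_times_def)
  have \<rho>: "stopping_time (natural_filtration M X) ?\<rho>"
    by (rule stopping_time_max[OF \<tau> tau_l_stopping_time])
  note meas_stop = stopping_time_measurable[OF \<tau>] stopping_time_measurable[OF \<rho>]
  have le: "running_cost \<phi>0 \<phi>1 ?\<rho> \<omega> t \<le> running_cost \<phi>0 \<phi>1 \<tau> \<omega> t" for \<omega> t
  proof -
    have "g (Phi0 \<phi>0 t \<omega>) (Phi1 \<phi>1 t \<omega>) < 0" if "0 \<le> t" "ennreal t < tau_l \<phi>0 \<phi>1 \<omega>"
      using that Inf_lower[of "ennreal t" "{ennreal t | t. 0 \<le> t \<and> Phi0 \<phi>0 t \<omega> + Phi1 \<phi>1 t \<omega> \<ge> lam / c}"]
      unfolding tau_l_def g_def by force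
    then show ?thesis
      by (auto simp: running_cost_def indicator_def less_max_iff_disj mult_le_0_iff)
  qed
  have J_le: "?J ?\<rho> \<omega> \<le> ?J \<tau> \<omega>" for \<omega>
    by (rule ext_integral_mono[OF le])
  have "expected_cost \<phi>0 \<phi>1 \<tau> \<le> expected_cost \<phi>0 \<phi>1 (\<lambda>_. 0)"
    unfolding V V_def by (rule INF_lower) (simp add: stopping_times_def stopping_time_const)
  also have "\<dots> = 0"
    by (simp add: expected_cost_def ext_integral_def zero_ennreal.rep_eq)
  finally have fin: "expected_cost \<phi>0 \<phi>1 \<tau> \<le> 0" .
  have ge: "expected_cost \<phi>0 \<phi>1 \<tau> \<le> expected_cost \<phi>0 \<phi>1 ?\<rho>"
    unfolding V V_def using \<rho> by (intro INF_lower) (simp add: stopping_times_def)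
  have neg: "(\<integral>\<^sup>+ \<omega>. e2ennreal (- ?J \<rho> \<omega>) \<partial>M) < \<infinity>" for \<rho>
  proof -
    have "(\<integral>\<^sup>+ \<omega>. e2ennreal (- ?J \<rho> \<omega>) \<partial>M) \<le> (\<integral>\<^sup>+ \<omega>. ennreal (1 / c) \<partial>M)"
      using running_cost_negative_part[OF _ \<phi>] ext_integral_uminus_le order_trans
      by (intro nn_integral_mono) blast
    also have "\<dots> < \<infinity>" by (simp add: emeasure_space_1)
    finally show ?thesis .
  qed
  have eq: "AE \<omega> in M. ?J ?\<rho> \<omega> = ?J \<tau> \<omega>"
    using ge fin neg unfolding expected_cost_eq
    by (intro ext_integral_le_imp_AE_eq measurable_ext_integral_running_cost J_le meas_stop) auto
  \<comment> \<open>on a path of infinite cost, \<open>?J ?\<rho> \<omega> = ?J \<tau> \<omega>\<close> would say nothing about the integrands\<close>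
  have "(\<integral>\<^sup>+ \<omega>. e2ennreal (?J \<tau> \<omega>) \<partial>M) \<noteq> \<infinity>"
    using fin neg[of \<tau>] unfolding expected_cost_eq ext_integral_def[of M]
    by (cases "\<integral>\<^sup>+ \<omega>. e2ennreal (- ?J \<tau> \<omega>) \<partial>M") (auto simp: enn2ereal_ennreal)
  then have "AE \<omega> in M. e2ennreal (?J \<tau> \<omega>) \<noteq> \<infinity>"
    using measurable_ext_integral_running_cost[OF meas_stop(1)] by (intro nn_integral_PInf_AE) auto
  with eq show ?thesis
  proof (rule AE_mp[OF AE_conjI], intro AE_I2 impI)
    fix \<omega> assume \<omega>: "\<omega> \<in> space M" and *: "?J ?\<rho> \<omega> = ?J \<tau> \<omega> \<and> e2ennreal (?J \<tau> \<omega>) \<noteq> \<infinity>"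
    have meas: "running_cost \<phi>0 \<phi>1 \<rho> \<omega> \<in> borel_measurable lborel" if "\<rho> \<in> borel_measurable M" for \<rho>
      using measurable_Pair2[OF measurable_running_cost[OF that] \<omega>] by simp
    have AE: "AE t in lborel. running_cost \<phi>0 \<phi>1 ?\<rho> \<omega> t = running_cost \<phi>0 \<phi>1 \<tau> \<omega> t"
    proof (rule ext_integral_le_imp_AE_eq[OF _ _ le])
      show "running_cost \<phi>0 \<phi>1 ?\<rho> \<omega> \<in> borel_measurable lborel"
        "running_cost \<phi>0 \<phi>1 \<tau> \<omega> \<in> borel_measurable lborel"
        by (intro meas meas_stop)+
      show "(\<integral>\<^sup>+ t. e2ennreal (- running_cost \<phi>0 \<phi>1 ?\<rho> \<omega> t) \<partial>lborel) < \<infinity>"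
        using running_cost_negative_part[OF \<omega> \<phi>] by (rule le_less_trans) simp
      show "?J \<tau> \<omega> < \<infinity>" using * by (cases "?J \<tau> \<omega>") auto
    qed (use * in simp)
    show "tau_l \<phi>0 \<phi>1 \<omega> \<le> \<tau> \<omega>"
    proof (rule ccontr)
      assume "\<not> tau_l \<phi>0 \<phi>1 \<omega> \<le> \<tau> \<omega>"
      then have less: "\<tau> \<omega> < tau_l \<phi>0 \<phi>1 \<omega>" by simp
      then obtain a where a: "0 \<le> a" "\<tau> \<omega> = ennreal a" by (cases "\<tau> \<omega>") auto
      obtain b where b: "a < b" "ennreal b < tau_l \<phi>0 \<phi>1 \<omega>"
        using dense[OF less] a by (metis ennreal_cases ennreal_less_iff top.not_eq_extremum order_less_trans less_le_not_le)
      have "running_cost \<phi>0 \<phi>1 ?\<rho> \<omega> t \<noteq> running_cost \<phi>0 \<phi>1 \<tau> \<omega> t" if t: "t \<in> {a..b}" for t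
      proof -
        have "ennreal t < tau_l \<phi>0 \<phi>1 \<omega>" using t b(2) by (meson atLeastAtMost_iff ennreal_leI order_le_less_trans)
        moreover from this have "g (Phi0 \<phi>0 t \<omega>) (Phi1 \<phi>1 t \<omega>) < 0"
          using a t Inf_lower[of "ennreal t" "{ennreal t | t. 0 \<le> t \<and> Phi0 \<phi>0 t \<omega> + Phi1 \<phi>1 t \<omega> \<ge> lam / c}"]
          unfolding tau_l_def g_def by force
        ultimately show ?thesis
          using t a by (auto simp: running_cost_def indicator_def less_max_iff_disj ennreal_less_iff)
      qed
      then have "AE t in lborel. t \<notin> {a..b}" using AE by (auto elim!: eventually_mono)
      moreover have "{t \<in> space lborel. \<not> t \<notin> {a..b}} = {a..b}" by auto
      ultimately have "emeasure lborel {a..b} = 0"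
        using AE_iff_measurable[of "{a..b}" lborel "\<lambda>t. t \<notin> {a..b}"] by simp
      then show False using b(1) by simp
    qed
  qed
qed

end

theorem lemma5p1:
  fixes M :: "'a measure"
    and lam \<mu> c m \<phi>0 \<phi>1 :: real
    and N :: "real \<Rightarrow> 'a \<Rightarrow> nat"
    and Y :: "nat \<Rightarrow> 'a \<Rightarrow> real ^ 'd"
    and X0 :: "'a \<Rightarrow> real ^ 'd"
    and \<beta>0 \<beta>1 :: "(real ^ 'd) measure"
    and r :: "real ^ 'd \<Rightarrow> real"
    and \<tau> :: "'a \<Rightarrow> ennreal"
  assumes "compound_poisson_disorder M lam \<mu> c m N Y X0 \<beta>0 \<beta>1 r"
    and "0 \<le> \<phi>0" and "0 \<le> \<phi>1"
    and "compound_poisson_disorder.optimal M lam \<mu> c m N Y X0 r \<phi>0 \<phi>1 \<tau>"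
  shows "AE \<omega> in M. compound_poisson_disorder.tau_l lam \<mu> c m N Y r \<phi>0 \<phi>1 \<omega> \<le> \<tau> \<omega>"
  using compound_poisson_disorder.tau_l_le_optimal[OF assms] .

end
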